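(* Let $G$ be a connected simple graph with essential connectivity $\kappa'$ and order $n\geq \kappa'+4$. Then $$\lambda_{1}(D(G))\geq\lambda_{1}\bigl(D(K_{\kappa'}\vee(K_{2}\cup K_{n-\kappa'-2}))\bigr),$$ with equality if and only if $G\cong K_{\kappa'}\vee(K_{2}\cup K_{n-\kappa'-2})$.
   Context: All graphs are finite, simple and connected (unless formed as disjoint unions or by deleting vertices). For a connected graph $G$ with vertices $v_1,\dots,v_n$, the distance matrix $D(G)=(d_{ij})$ is the $n\times n$ matrix whose $(i,j)$-entry $d_{ij}$ is the length of a shortest path from $v_i$ to $v_j$. $\lambda_1(D(G))$ denotes the largest eigenvalue of the real symmetric matrix $D(G)$ (the distance spectral radius). A graph is non-trivial if it contains at least one nonloop edge. A vertex set $S\subseteq V(G)$ is an essential vertex-cut of $G$ if $G-S$ is disconnected and at least two components of $G-S$ are non-trivial. The essential connectivity $\kappa'=\kappa'(G)$ is the minimum size of an essential vertex-cut of $G$ (saying that $G$ has essential connectivity $\kappa'$ presupposes that an essential vertex-cut exists). $K_m$ is the complete graph on $m$ vertices; $G_1\cup G_2$ is the disjoint union of vertex-disjoint graphs; the join $G_1\vee G_2$ is obtained from $G_1\cup G_2$ by adding all edges between $V(G_1)$ and $V(G_2)$. *)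

theory Defs
  imports
    "Graph_Theory.Graph_Theory"
    "Jordan_Normal_Form.Spectral_Radius"
begin

text \<open>
  A finite simple undirected graph is a \<open>graph\<close> of \<open>Graph_Theory\<close>: a finite symmetric digraph
  without loops and without parallel arcs, each edge being represented by its two orientations.
\<close>

definition graph_dist :: "('a, 'b) pre_digraph \<Rightarrow> 'a \<Rightarrow> 'a \<Rightarrow> nat" where
  "graph_dist G u v = (LEAST k. \<exists>p. pre_digraph.apath G u p v \<and> length p = k)"

text \<open>
  The vertices are listed in an arbitrary fixed order. Another order conjugates the matrix by a
  permutation matrix, so the spectrum does not depend on the choice.
\<close>

definition vertex_list :: "('a, 'b) pre_digraph \<Rightarrow> 'a list" where
  "vertex_list G = (SOME vs. distinct vs \<and> set vs = verts G)"

definition distance_matrix :: "('a, 'b) pre_digraph \<Rightarrow> real mat" where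
  "distance_matrix G =
     mat (card (verts G)) (card (verts G))
       (\<lambda>(i, j). real (graph_dist G (vertex_list G ! i) (vertex_list G ! j)))"

text \<open>
  Only applied to real symmetric matrices of positive order, whose spectrum is finite and nonempty.
\<close>

definition largest_eigenvalue :: "real mat \<Rightarrow> real" where
  "largest_eigenvalue A = Max (spectrum A)"

definition nontrivial_graph :: "('a, 'b) pre_digraph \<Rightarrow> bool" where
  "nontrivial_graph G \<longleftrightarrow> (\<exists>e \<in> arcs G. tail G e \<noteq> head G e)"

definition delete_vertices :: "('a, 'b) pre_digraph \<Rightarrow> 'a set \<Rightarrow> ('a, 'b) pre_digraph" where
  "delete_vertices G S = G \<restriction> (verts G - S)"

text \<open>
  For a symmetric digraph the strongly connected components are the connected components of the
  undirected graph. The name \<open>connected\<close> is qualified because it also denotes topological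
  connectedness.
\<close>

definition essential_vertex_cut :: "('a, 'b) pre_digraph \<Rightarrow> 'a set \<Rightarrow> bool" where
  "essential_vertex_cut G S \<longleftrightarrow>
     S \<subseteq> verts G \<and>
     \<not> Digraph_Component.connected (delete_vertices G S) \<and>
     (\<exists>C \<in> pre_digraph.sccs (delete_vertices G S). \<exists>D \<in> pre_digraph.sccs (delete_vertices G S).
        C \<noteq> D \<and> nontrivial_graph C \<and> nontrivial_graph D)"

text \<open>Meaningful only if \<open>G\<close> has an essential vertex-cut.\<close>

definition essential_connectivity :: "('a, 'b) pre_digraph \<Rightarrow> nat" where
  "essential_connectivity G = (LEAST k. \<exists>S. essential_vertex_cut G S \<and> card S = k)"

definition complete_graph :: "nat \<Rightarrow> nat pair_pre_digraph" where
  "complete_graph m = \<lparr> pverts = {..<m}, parcs = {(i, j). i < m \<and> j < m \<and> i \<noteq> j} \<rparr>"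

definition disjoint_union ::
  "'a pair_pre_digraph \<Rightarrow> 'b pair_pre_digraph \<Rightarrow> ('a + 'b) pair_pre_digraph" where
  "disjoint_union G H =
     \<lparr> pverts = pverts G <+> pverts H,
       parcs = {(Inl u, Inl v) |u v. (u, v) \<in> parcs G}
         \<union> {(Inr u, Inr v) |u v. (u, v) \<in> parcs H} \<rparr>"

definition join_graph ::
  "'a pair_pre_digraph \<Rightarrow> 'b pair_pre_digraph \<Rightarrow> ('a + 'b) pair_pre_digraph" where
  "join_graph G H =
     \<lparr> pverts = pverts (disjoint_union G H),
       parcs = parcs (disjoint_union G H)
         \<union> (Inl ` pverts G) \<times> (Inr ` pverts H) \<union> (Inr ` pverts H) \<times> (Inl ` pverts G) \<rparr>"

lemma pair_graph_complete_graph: "pair_graph (complete_graph m)"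
proof -
  have "finite (parcs (complete_graph m))"
    by (rule finite_subset[of _ "{..<m} \<times> {..<m}"]) (auto simp: complete_graph_def)
  then show ?thesis
    by unfold_locales
      (auto simp: complete_graph_def symmetric_def sym_def)
qed

lemma complete_digraph_complete_graph: "complete_digraph m (with_proj (complete_graph m))"
proof -
  interpret pair_graph "complete_graph m" by (rule pair_graph_complete_graph)
  have "graph (with_proj (complete_graph m))" by unfold_locales
  then show ?thesis by (auto simp: complete_digraph_def complete_graph_def)
qed

lemma pair_graph_disjoint_union:
  assumes "pair_graph G" "pair_graph H"
  shows "pair_graph (disjoint_union G H)"
proof -
  interpret G: pair_graph G by fact
  interpret H: pair_graph H by fact
  have "parcs (disjoint_union G H)
      \<subseteq> map_prod Inl Inl ` parcs G \<union> map_prod Inr Inr ` parcs H"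
    by (force simp: disjoint_union_def)
  then have "finite (parcs (disjoint_union G H))"
    by (rule finite_subset) (simp add: G.pair_finite_arcs H.pair_finite_arcs)
  then show ?thesis
    using G.pair_no_loops H.pair_no_loops G.pair_sym_arcs H.pair_sym_arcs
    by unfold_locales
      (auto simp: disjoint_union_def symmetric_def sym_def
        G.pair_finite_verts H.pair_finite_verts dest: G.wellformed' H.wellformed')
qed

lemma pair_graph_join_graph:
  assumes "pair_graph G" "pair_graph H"
  shows "pair_graph (join_graph G H)"
proof -
  interpret G: pair_graph G by fact
  interpret H: pair_graph H by fact
  interpret U: pair_graph "disjoint_union G H"
    using assms by (rule pair_graph_disjoint_union)
  have V: "pverts (disjoint_union G H) = Inl ` pverts G \<union> Inr ` pverts H"
    by (auto simp: disjoint_union_def)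
  show ?thesis
    using U.pair_no_loops U.pair_sym_arcs U.pair_finite_verts U.pair_finite_arcs
    by unfold_locales
      (auto simp: join_graph_def symmetric_def sym_def V
        G.pair_finite_verts H.pair_finite_verts dest: U.wellformed')
qed

end

theory Submission
  imports Defs "HOL-Analysis.Function_Topology"
begin

text \<open>
  Let \<open>S\<close> be an essential vertex-cut of minimum size \<open>\<kappa>\<close>, \<open>A\<close> a non-trivial component of \<open>G - S\<close>
  and \<open>B\<close> the remaining vertices, with the names chosen so that \<open>|A| \<le> |B|\<close>. Vertices of \<open>A\<close> and
  \<open>B\<close> have distance at least 2, so \<open>D(G)\<close> dominates entrywise the distance matrix \<open>D\<^sub>A\<^sub>B\<close> of
  \<open>K\<^sub>\<kappa> \<or> (K\<^sub>|\<^sub>A\<^sub>| \<union> K\<^sub>|\<^sub>B\<^sub>|)\<close>. Choose a two-element subset \<open>A'\<close> of \<open>A\<close>, move the rest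
  of \<open>A\<close> to \<open>B\<close>, and let \<open>x > 0\<close> be the Perron vector of the resulting extremal graph on the same
  vertices. It takes one value on \<open>A'\<close> and one on the other side, and comparing these values shows
  that the quadratic form of \<open>x\<close> increases strictly when the moved vertices return to \<open>A\<close>. Hence the
  Rayleigh quotient of \<open>x\<close> for \<open>D(G)\<close> is at least the largest eigenvalue of the extremal graph,
  and equality forces \<open>A = A'\<close> and \<open>D(G) = D\<^sub>A\<^sub>B\<close>.
\<close>

section \<open>Quadratic forms and the Perron vector\<close>

definition quad_form :: "'a set \<Rightarrow> ('a \<Rightarrow> 'a \<Rightarrow> real) \<Rightarrow> ('a \<Rightarrow> real) \<Rightarrow> real" where
  "quad_form V d f = (\<Sum>u\<in>V. f u * (\<Sum>v\<in>V. d u v * f v))"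

text \<open>The equation is indexed by vertices instead of positions and imposed on \<open>V\<close>
  only, so it depends on no listing of the vertices, and relabelling becomes reindexing of
  sums.\<close>

definition eigenpair_on :: "'a set \<Rightarrow> ('a \<Rightarrow> 'a \<Rightarrow> real) \<Rightarrow> real \<Rightarrow> ('a \<Rightarrow> real) \<Rightarrow> bool" where
  "eigenpair_on V d \<mu> f \<longleftrightarrow> (\<exists>v\<in>V. f v \<noteq> 0) \<and> (\<forall>u\<in>V. (\<Sum>v\<in>V. d u v * f v) = \<mu> * f u)"

lemma quad_form_eigenpair_on:
  assumes "eigenpair_on V d \<mu> f"
  shows "quad_form V d f = \<mu> * (\<Sum>v\<in>V. (f v)\<^sup>2)"
  using assms unfolding quad_form_def eigenpair_on_def
  by (simp add: sum_distrib_left power2_eq_square mult.left_commute)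

lemma sum_squares_pos:
  fixes f :: "'a \<Rightarrow> real"
  assumes "finite V" "v \<in> V" "f v \<noteq> 0"
  shows "0 < (\<Sum>v\<in>V. (f v)\<^sup>2)"
  using assms by (intro sum_pos2[of V v]) auto

lemma quad_form_scale: "quad_form V d (\<lambda>v. c * f v) = c\<^sup>2 * quad_form V d f"
  unfolding quad_form_def
  by (simp add: sum_distrib_left power2_eq_square mult_ac)

lemma quad_form_cong:
  assumes "\<And>v. v \<in> V \<Longrightarrow> f v = g v" "\<And>u v. u \<in> V \<Longrightarrow> v \<in> V \<Longrightarrow> d u v = e u v"
  shows "quad_form V d f = quad_form V e g"
  unfolding quad_form_def using assms by (auto intro!: sum.cong)

text \<open>Symmetry of \<open>d\<close> merges the two cross terms. The expansion serves the
  perturbation argument for maximisers.\<close>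

lemma quad_form_add:
  assumes sym: "\<And>u v. u \<in> V \<Longrightarrow> v \<in> V \<Longrightarrow> d u v = d v u"
  shows "quad_form V d (\<lambda>v. f v + t * g v) =
    quad_form V d f + 2 * t * (\<Sum>u\<in>V. g u * (\<Sum>v\<in>V. d u v * f v)) + t\<^sup>2 * quad_form V d g"
proof -
  have swap: "(\<Sum>u\<in>V. f u * (\<Sum>v\<in>V. d u v * g v)) = (\<Sum>u\<in>V. g u * (\<Sum>v\<in>V. d u v * f v))"
    unfolding sum_distrib_left
    by (subst sum.swap) (auto intro!: sum.cong simp: sym)
  have "quad_form V d (\<lambda>v. f v + t * g v) =
      quad_form V d f + t * (\<Sum>u\<in>V. f u * (\<Sum>v\<in>V. d u v * g v))
        + t * (\<Sum>u\<in>V. g u * (\<Sum>v\<in>V. d u v * f v)) + t\<^sup>2 * quad_form V d g"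
    unfolding quad_form_def
    by (simp add: algebra_simps sum.distrib sum_distrib_left power2_eq_square)
  then show ?thesis unfolding swap by simp
qed

text \<open>The form is continuous on the compact unit sphere, so it attains a maximum
  \<open>M\<close> there; homogeneity of degree 2 carries the bound over to all
  \<open>f\<close>.\<close>

lemma quad_form_maximiser:
  fixes d :: "'a \<Rightarrow> 'a \<Rightarrow> real"
  assumes fin: "finite V" and ne: "V \<noteq> {}"
  obtains M x where "(\<Sum>v\<in>V. (x v)\<^sup>2) = 1" "quad_form V d x = M"
    "\<And>f. quad_form V d f \<le> M * (\<Sum>v\<in>V. (f v)\<^sup>2)"
proof -
  \<comment> \<open>Fixing the value 0 outside \<open>V\<close> keeps the cube compact in the product topology.\<close>
  define K where "K = PiE UNIV (\<lambda>v. if v \<in> V then {-1..1::real} else {0}) \<inter> {f. (\<Sum>v\<in>V. (f v)\<^sup>2) = 1}"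
  have coord: "continuous_on U (\<lambda>f::'a \<Rightarrow> real. f v)" for U v
    by (rule continuous_on_subset[OF continuous_on_product_coordinates]) auto
  have "compact (PiE UNIV (\<lambda>v. if v \<in> V then {-1..1::real} else {0}))"
    using compactin_PiE[of "\<lambda>_::'a. euclidean" UNIV "\<lambda>v. if v \<in> V then {-1..1::real} else {0}"]
    by (simp add: euclidean_product_topology)
  moreover have "closed {f::'a \<Rightarrow> real. (\<Sum>v\<in>V. (f v)\<^sup>2) = 1}"
    by (intro closed_Collect_eq continuous_intros coord)
  ultimately have "compact K" unfolding K_def by (rule compact_Int_closed)
  \<comment> \<open>Cutting \<open>f\<close> off outside \<open>V\<close> does not change its form,
    and the coordinates of a unit vector lie between -1 and 1, so \<open>K\<close> represents the
    whole unit sphere.\<close>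
  have unit_in: "(\<lambda>v. if v \<in> V then f v else 0) \<in> K" if "(\<Sum>v\<in>V. (f v)\<^sup>2) = 1" for f
  proof -
    have "(f v)\<^sup>2 \<le> 1" if "v \<in> V" for v
      using member_le_sum[of v V "\<lambda>v. (f v)\<^sup>2"] that fin \<open>(\<Sum>v\<in>V. (f v)\<^sup>2) = 1\<close> by auto
    then have "\<bar>f v\<bar> \<le> 1" if "v \<in> V" for v
      using that abs_square_le_1 by blast
    then show ?thesis using that unfolding K_def by (auto simp: abs_le_iff minus_le_iff)
  qed
  obtain v0 where v0: "v0 \<in> V" using ne by blast
  have "(\<Sum>v\<in>V. (if v = v0 then 1 else 0 :: real)\<^sup>2) = 1"
    using fin v0 by (simp add: if_distrib[of "\<lambda>x. x\<^sup>2"] sum.delta cong: if_cong)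
  from unit_in[OF this] have "K \<noteq> {}" by blast
  have "continuous_on K (quad_form V d)"
    unfolding quad_form_def by (intro continuous_intros coord)
  from continuous_attains_sup[OF \<open>compact K\<close> \<open>K \<noteq> {}\<close> this]
  obtain x where x: "x \<in> K" and max: "\<And>f. f \<in> K \<Longrightarrow> quad_form V d f \<le> quad_form V d x"
    by blast
  have bound: "quad_form V d f \<le> quad_form V d x * (\<Sum>v\<in>V. (f v)\<^sup>2)" for f
  proof (cases "\<exists>v\<in>V. f v \<noteq> 0")
    case False
    then show ?thesis by (simp add: quad_form_def)
  next
    case True
    define s where "s = (\<Sum>v\<in>V. (f v)\<^sup>2)"
    have s: "s > 0" unfolding s_def using True sum_squares_pos[OF fin] by blast
    define g where "g = (\<lambda>v. (1 / sqrt s) * f v)"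
    have sq: "(1 / sqrt s)\<^sup>2 = 1 / s" using s by (simp add: power_divide)
    have "(\<Sum>v\<in>V. (g v)\<^sup>2) = 1"
      unfolding g_def power_mult_distrib sq using s by (simp flip: sum_divide_distrib s_def)
    from max[OF unit_in[OF this]] have "quad_form V d (\<lambda>v. if v \<in> V then g v else 0) \<le> quad_form V d x" .
    moreover have "quad_form V d (\<lambda>v. if v \<in> V then g v else 0) = quad_form V d g"
      by (rule quad_form_cong) auto
    moreover have "quad_form V d g = quad_form V d f / s"
      unfolding g_def quad_form_scale sq by simp
    ultimately show ?thesis using s by (simp add: field_simps s_def[symmetric])
  qed
  from x have "(\<Sum>v\<in>V. (x v)\<^sup>2) = 1" unfolding K_def by simp
  from that[OF this refl bound] show ?thesis .
qed

lemma eigenpair_on_maximiser: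
  assumes fin: "finite V"
    and sym: "\<And>u v. u \<in> V \<Longrightarrow> v \<in> V \<Longrightarrow> d u v = d v u"
    and bound: "\<And>f. quad_form V d f \<le> M * (\<Sum>v\<in>V. (f v)\<^sup>2)"
    and max: "quad_form V d x = M * (\<Sum>v\<in>V. (x v)\<^sup>2)"
    and ne: "\<exists>v\<in>V. x v \<noteq> 0"
  shows "eigenpair_on V d M x"
proof -
  \<comment> \<open>Perturb \<open>x\<close> along its own residual; maximality makes the first-order term, its squared norm, vanish.\<close>
  define r where "r = (\<lambda>u. M * x u - (\<Sum>v\<in>V. d u v * x v))"
  define S where "S = (\<Sum>u\<in>V. (r u)\<^sup>2)"
  define C where "C = M * S - quad_form V d r"
  have C: "C \<ge> 0" unfolding C_def S_def using bound by simp
  \<comment> \<open>The right-hand side is the gap in \<open>bound\<close> at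
    \<open>x + t r\<close>: the constant term cancels by \<open>max\<close>, and the definition of
    \<open>r\<close> makes the linear coefficient \<open>2 * S\<close>.\<close>
  have first: "0 \<le> 2 * t * S + t\<^sup>2 * C" for t
  proof -
    have sq: "(\<Sum>v\<in>V. (x v + t * r v)\<^sup>2) = (\<Sum>v\<in>V. (x v)\<^sup>2) + 2 * t * (\<Sum>v\<in>V. r v * x v) + t\<^sup>2 * S"
      unfolding S_def by (simp add: power2_eq_square algebra_simps sum.distrib sum_distrib_left)
    have "S = (\<Sum>u\<in>V. r u * (M * x u - (\<Sum>v\<in>V. d u v * x v)))"
      unfolding S_def r_def power2_eq_square ..
    then have S: "S = M * (\<Sum>v\<in>V. r v * x v) - (\<Sum>u\<in>V. r u * (\<Sum>v\<in>V. d u v * x v))"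
      by (simp add: right_diff_distrib sum_subtractf sum_distrib_left mult_ac)
    have expand: "quad_form V d (\<lambda>v. x v + t * r v) =
        quad_form V d x + 2 * t * (\<Sum>u\<in>V. r u * (\<Sum>v\<in>V. d u v * x v)) + t\<^sup>2 * quad_form V d r"
      by (rule quad_form_add) (rule sym)
    have "2 * t * S + t\<^sup>2 * C = M * (\<Sum>v\<in>V. (x v + t * r v)\<^sup>2) - quad_form V d (\<lambda>v. x v + t * r v)"
      unfolding sq expand max C_def by (subst (1) S) (simp add: algebra_simps)
    then show ?thesis using bound by simp
  qed
  have "S = 0"
  proof -
    \<comment> \<open>For positive \<open>C\<close> the quadratic is smallest at
      \<open>- S / C\<close>. The added \<open>1\<close> covers \<open>C = 0\<close>, and the value
      at \<open>t\<close> is still negative unless \<open>S = 0\<close>.\<close>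
    define t where "t = - S / (C + 1)"
    have t: "t * (C + 1) = - S" using C unfolding t_def by simp
    have "0 \<le> (2 * t * S + t\<^sup>2 * C) * (C + 1)\<^sup>2"
      using first by (intro mult_nonneg_nonneg) auto
    also have "\<dots> = 2 * (t * (C + 1)) * S * (C + 1) + (t * (C + 1))\<^sup>2 * C"
      by (simp add: power2_eq_square algebra_simps)
    also have "\<dots> = - (S\<^sup>2 * (C + 2))"
      unfolding t by (simp add: power2_eq_square algebra_simps)
    finally show ?thesis using C by (simp add: mult_le_0_iff)
  qed
  then have "\<forall>u\<in>V. r u = 0"
    unfolding S_def using fin by (simp add: sum_nonneg_eq_0_iff)
  then show ?thesis using ne unfolding eigenpair_on_def r_def by auto
qed

text \<open>Since \<open>d\<close> is nonnegative, replacing a maximiser by its absolute value does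
  not lower the form, so the absolute value is a maximiser and hence an eigenvector. A zero entry at
  \<open>u\<close> would make row \<open>u\<close> of the product vanish, although some other entry
  contributes a positive term.\<close>

lemma perron:
  fixes d :: "'a \<Rightarrow> 'a \<Rightarrow> real"
  assumes fin: "finite V" and ne: "V \<noteq> {}"
    and sym: "\<And>u v. u \<in> V \<Longrightarrow> v \<in> V \<Longrightarrow> d u v = d v u"
    and nonneg: "\<And>u v. u \<in> V \<Longrightarrow> v \<in> V \<Longrightarrow> 0 \<le> d u v"
    and pos: "\<And>u v. u \<in> V \<Longrightarrow> v \<in> V \<Longrightarrow> u \<noteq> v \<Longrightarrow> 0 < d u v"
  obtains M x where "eigenpair_on V d M x" "\<And>v. v \<in> V \<Longrightarrow> 0 < x v"
    "\<And>f. quad_form V d f \<le> M * (\<Sum>v\<in>V. (f v)\<^sup>2)"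
proof -
  obtain M y where y: "(\<Sum>v\<in>V. (y v)\<^sup>2) = 1" "quad_form V d y = M"
    and bound: "\<And>f. quad_form V d f \<le> M * (\<Sum>v\<in>V. (f v)\<^sup>2)"
    using quad_form_maximiser[OF fin ne] by blast
  define x where "x = (\<lambda>v. \<bar>y v\<bar>)"
  have x1: "(\<Sum>v\<in>V. (x v)\<^sup>2) = 1" using y by (simp add: x_def)
  have nz: "\<exists>v\<in>V. x v \<noteq> 0"
  proof (rule ccontr)
    assume "\<not> ?thesis"
    with x1 show False by simp
  qed
  have "quad_form V d y \<le> quad_form V d x"
    unfolding quad_form_def sum_distrib_left
  proof (intro sum_mono)
    fix u v assume uv: "u \<in> V" "v \<in> V"
    have "d u v * (y u * y v) \<le> d u v * \<bar>y u * y v\<bar>"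
      using nonneg[OF uv] by (intro mult_left_mono) auto
    then show "y u * (d u v * y v) \<le> x u * (d u v * x v)"
      by (simp add: x_def abs_mult mult_ac)
  qed
  with y x1 bound[of x] have "quad_form V d x = M * (\<Sum>v\<in>V. (x v)\<^sup>2)" by simp
  from eigenpair_on_maximiser[OF fin sym bound this nz] have eig: "eigenpair_on V d M x" by blast
  have "0 < x u" if u: "u \<in> V" for u
  proof (rule ccontr)
    assume "\<not> ?thesis"
    then have "x u = 0" by (simp add: x_def)
    obtain v where v: "v \<in> V" "x v \<noteq> 0" using nz by blast
    have "0 < d u v * x v" using v u pos[of u v] \<open>x u = 0\<close>
      by (intro mult_pos_pos) (auto simp: x_def)
    also have "\<dots> \<le> (\<Sum>v\<in>V. d u v * x v)"
      using v u nonneg fin by (intro member_le_sum) (auto simp: x_def)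
    also have "\<dots> = 0" using eig u \<open>x u = 0\<close> unfolding eigenpair_on_def by simp
    finally show False by simp
  qed
  from that[OF eig this bound] show ?thesis by blast
qed

text \<open>The bijection from positions to listed vertices turns coordinate vectors into functions
  on \<open>set vs\<close>. From here on, eigenvalues can be handled without matrices.\<close>

lemma eigenvalue_mat_conv_eigenpair_on:
  fixes d :: "'a \<Rightarrow> 'a \<Rightarrow> real"
  assumes "distinct vs"
  shows "eigenvalue (mat (length vs) (length vs) (\<lambda>(i, j). d (vs ! i) (vs ! j))) \<mu>
    \<longleftrightarrow> (\<exists>f. eigenpair_on (set vs) d \<mu> f)"
proof -
  let ?n = "length vs"
  let ?A = "mat ?n ?n (\<lambda>(i, j). d (vs ! i) (vs ! j))"
  have bij: "bij_betw ((!) vs) {..<?n} (set vs)"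
    using assms by (simp add: bij_betw_nth lessThan_atLeast0)
  have conv: "eigenvector ?A (vec ?n (\<lambda>i. f (vs ! i))) \<mu> \<longleftrightarrow> eigenpair_on (set vs) d \<mu> f" for f
  proof -
    have "vec ?n (\<lambda>i. f (vs ! i)) \<noteq> 0\<^sub>v ?n \<longleftrightarrow> (\<exists>v\<in>set vs. f v \<noteq> 0)"
      by (auto simp: vec_eq_iff Bex_def in_set_conv_nth)
    moreover have "?A *\<^sub>v vec ?n (\<lambda>i. f (vs ! i)) = \<mu> \<cdot>\<^sub>v vec ?n (\<lambda>i. f (vs ! i))
      \<longleftrightarrow> (\<forall>u\<in>set vs. (\<Sum>j<?n. d u (vs ! j) * f (vs ! j)) = \<mu> * f u)"
      by (auto simp: vec_eq_iff scalar_prod_def lessThan_atLeast0 all_set_conv_all_nth)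
    moreover have "(\<Sum>j<?n. d u (vs ! j) * f (vs ! j)) = (\<Sum>v\<in>set vs. d u v * f v)" for u
      using sum.reindex_bij_betw[OF bij] .
    ultimately show ?thesis
      unfolding eigenvector_def eigenpair_on_def by simp
  qed
  show ?thesis
  proof
    assume "eigenvalue ?A \<mu>"
    then obtain w where w: "eigenvector ?A w \<mu>" unfolding eigenvalue_def by blast
    define f where "f = (\<lambda>v. w $ (the_inv_into {..<?n} ((!) vs) v))"
    have "w = vec ?n (\<lambda>i. f (vs ! i))"
      using w bij unfolding eigenvector_def f_def
      by (auto simp: vec_eq_iff the_inv_into_f_f bij_betw_def)
    with w conv show "\<exists>f. eigenpair_on (set vs) d \<mu> f" by metis
  next
    assume "\<exists>f. eigenpair_on (set vs) d \<mu> f"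
    then show "eigenvalue ?A \<mu>" unfolding eigenvalue_def using conv by blast
  qed
qed

abbreviation (input) "distance_on G \<equiv> (\<lambda>u v. real (graph_dist G u v))"

lemma spectrum_distance_matrix:
  assumes "finite (verts G)"
  shows "spectrum (distance_matrix G) = {\<mu>. \<exists>f. eigenpair_on (verts G) (distance_on G) \<mu> f}"
proof -
  have "distinct (vertex_list G) \<and> set (vertex_list G) = verts G"
    unfolding vertex_list_def using finite_distinct_list[OF assms] by (metis (mono_tags, lifting) someI_ex)
  moreover from this have "length (vertex_list G) = card (verts G)"
    by (metis distinct_card)
  ultimately show ?thesis
    unfolding spectrum_def distance_matrix_def
    using eigenvalue_mat_conv_eigenpair_on[of "vertex_list G" "distance_on G"] by auto
qed

text \<open>Every eigenvalue is the Rayleigh quotient of its eigenvector, so an eigenvalue that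
  bounds all Rayleigh quotients is the largest.\<close>

lemma largest_eigenvalue_distance_matrixI:
  assumes fin: "finite (verts G)"
    and eig: "eigenpair_on (verts G) (distance_on G) M x"
    and bound: "\<And>f. quad_form (verts G) (distance_on G) f \<le> M * (\<Sum>v\<in>verts G. (f v)\<^sup>2)"
  shows "largest_eigenvalue (distance_matrix G) = M"
  unfolding largest_eigenvalue_def
proof (rule Max_eqI)
  have "distance_matrix G \<in> carrier_mat (card (verts G)) (card (verts G))"
    unfolding distance_matrix_def by simp
  then show "finite (spectrum (distance_matrix G))" by (rule card_finite_spectrum)
  show "M \<in> spectrum (distance_matrix G)"
    unfolding spectrum_distance_matrix[OF fin] using eig by blast
next
  fix \<mu> assume "\<mu> \<in> spectrum (distance_matrix G)"
  then obtain f where f: "eigenpair_on (verts G) (distance_on G) \<mu> f"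
    unfolding spectrum_distance_matrix[OF fin] by blast
  then have "0 < (\<Sum>v\<in>verts G. (f v)\<^sup>2)"
    unfolding eigenpair_on_def using sum_squares_pos[OF fin] by blast
  then show "\<mu> \<le> M" using bound[of f] quad_form_eigenpair_on[OF f] by simp
qed

section \<open>Quadratic forms of separated distances\<close>

text \<open>For disjoint \<open>A\<close> and \<open>B\<close> this is the distance in the join of a
  complete graph on the remaining vertices, if there are any, with the disjoint union of complete
  graphs on \<open>A\<close> and \<open>B\<close>.\<close>

definition sep_dist :: "'a set \<Rightarrow> 'a set \<Rightarrow> 'a \<Rightarrow> 'a \<Rightarrow> real" where
  "sep_dist A B u v =
    (if u = v then 0 else if u \<in> A \<and> v \<in> B \<or> u \<in> B \<and> v \<in> A then 2 else 1)"

text \<open>The matrix is all ones, minus the identity, plus one on the pairs split between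
  \<open>A\<close> and \<open>B\<close>.\<close>

lemma sep_dist_row:
  assumes fin: "finite V" and u: "u \<in> V" and AB: "A \<subseteq> V" "B \<subseteq> V" "A \<inter> B = {}"
  shows "(\<Sum>v\<in>V. sep_dist A B u v * x v) =
    sum x V - x u + of_bool (u \<in> A) * sum x B + of_bool (u \<in> B) * sum x A"
proof -
  have part: "(\<Sum>v\<in>V. of_bool (v \<in> W) * x v) = sum x W" if "W \<subseteq> V" for W
    using fin that by (simp add: sum_of_bool_mult_eq Int_absorb1)
  have diag: "(\<Sum>v\<in>V. of_bool (u = v) * x v) = x u"
    using fin u by (simp add: sum_of_bool_mult_eq)
  have "sep_dist A B u v * x v = x v - of_bool (u = v) * x v
      + of_bool (u \<in> A) * (of_bool (v \<in> B) * x v) + of_bool (u \<in> B) * (of_bool (v \<in> A) * x v)" for v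
    using AB by (auto simp: sep_dist_def)
  then show ?thesis
    using AB by (simp add: sum.distrib sum_subtractf diag part flip: sum_distrib_left)
qed

text \<open>Only the last term depends on the partition, so for a fixed \<open>x\<close> comparing
  two partitions means comparing products of two block sums.\<close>

lemma quad_form_sep_dist:
  assumes fin: "finite V" and AB: "A \<subseteq> V" "B \<subseteq> V" "A \<inter> B = {}"
  shows "quad_form V (sep_dist A B) x = (sum x V)\<^sup>2 - (\<Sum>v\<in>V. (x v)\<^sup>2) + 2 * sum x A * sum x B"
proof -
  have part: "(\<Sum>v\<in>V. of_bool (v \<in> W) * x v) = sum x W" if "W \<subseteq> V" for W
    using fin that by (simp add: sum_of_bool_mult_eq Int_absorb1)
  have "quad_form V (sep_dist A B) x = (\<Sum>u\<in>V. x u * sum x V - (x u)\<^sup>2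
      + (of_bool (u \<in> A) * x u) * sum x B + (of_bool (u \<in> B) * x u) * sum x A)"
    unfolding quad_form_def
    by (intro sum.cong refl) (subst sep_dist_row[OF fin _ AB], auto simp: algebra_simps power2_eq_square)
  also have "\<dots> = (sum x V)\<^sup>2 - (\<Sum>v\<in>V. (x v)\<^sup>2) + 2 * sum x A * sum x B"
    using AB by (simp add: sum.distrib sum_subtractf part power2_eq_square flip: sum_distrib_right)
  finally show ?thesis .
qed

text \<open>The difference of the forms is a sum of nonnegative terms
  \<open>(e u v - d u v) * (x u * x v)\<close>. If it vanishes, so does every term, and positivity
  of \<open>x\<close> leaves only the first factor.\<close>

lemma quad_form_mono_positive:
  assumes fin: "finite V"
    and pos: "\<And>v. v \<in> V \<Longrightarrow> 0 < x v"
    and le: "\<And>u v. u \<in> V \<Longrightarrow> v \<in> V \<Longrightarrow> d u v \<le> e u v"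
  shows "quad_form V d x \<le> quad_form V e x"
    and "quad_form V d x = quad_form V e x \<Longrightarrow> u \<in> V \<Longrightarrow> v \<in> V \<Longrightarrow> d u v = e u v"
proof -
  have diff: "quad_form V e x - quad_form V d x = (\<Sum>u\<in>V. \<Sum>v\<in>V. (e u v - d u v) * (x u * x v))"
    unfolding quad_form_def
    by (simp add: sum_distrib_left algebra_simps flip: sum_subtractf)
  have nonneg: "0 \<le> (e u v - d u v) * (x u * x v)" if "u \<in> V" "v \<in> V" for u v
    using that le pos by (intro mult_nonneg_nonneg) (auto intro: less_imp_le)
  show "quad_form V d x \<le> quad_form V e x"
    using diff nonneg by (smt (verit) sum_nonneg)
  assume "quad_form V d x = quad_form V e x" and uv: "u \<in> V" "v \<in> V"
  with diff have "(\<Sum>u\<in>V. \<Sum>v\<in>V. (e u v - d u v) * (x u * x v)) = 0" by simp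
  then have "(e u v - d u v) * (x u * x v) = 0"
    using uv nonneg fin by (simp add: sum_nonneg_eq_0_iff sum_nonneg)
  then show "d u v = e u v" using pos[OF uv(1)] pos[OF uv(2)] by simp
qed

text \<open>With \<open>C = A - A'\<close>, returning \<open>C\<close> to \<open>A\<close> changes
  the form by \<open>2 * sum x C * (sum x B - sum x A')\<close>, so \<open>B\<close> has to outweigh
  \<open>A'\<close>. The eigenvalue equation makes \<open>x\<close> constant on \<open>A'\<close>
  and on \<open>B \<union> C\<close>, which reduces this to an inequality in the two values and the
  block sizes.\<close>

lemma quad_form_sep_dist_less:
  assumes fin: "finite V"
    and AB: "A \<subseteq> V" "B \<subseteq> V" "A \<inter> B = {}"
    and card: "card A \<le> card B" "A' \<subset> A" "card A' = 2"
    and pos: "\<And>v. v \<in> V \<Longrightarrow> 0 < x v"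
    and eig: "eigenpair_on V (sep_dist A' (B \<union> (A - A'))) M x"
  shows "quad_form V (sep_dist A' (B \<union> (A - A'))) x < quad_form V (sep_dist A B) x"
proof -
  define C where "C = A - A'"
  \<comment> \<open>The shift by one absorbs the term \<open>- x u\<close> that the zero diagonal
    leaves in each row.\<close>
  define L where "L = M + 1"
  define T where "T = sum x V"
  have finAB: "finite A" "finite B" "finite A'" "finite C"
    using finite_subset[OF AB(1) fin] finite_subset[OF AB(2) fin] finite_subset[of A' A] card(2)
    unfolding C_def by auto
  have sub: "A' \<subseteq> V" "B \<union> C \<subseteq> V" "A' \<inter> (B \<union> C) = {}" "B \<inter> C = {}" "A = A' \<union> C" "A' \<inter> C = {}"
    using AB card(2) unfolding C_def by auto
  have row: "L * x u = T + of_bool (u \<in> A') * sum x (B \<union> C) + of_bool (u \<in> B \<union> C) * sum x A'"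
    if "u \<in> V" for u
    using eig that sep_dist_row[OF fin that sub(1-3), of x]
    unfolding eigenpair_on_def C_def[symmetric] L_def T_def by (simp add: algebra_simps)
  have cA: "card A = 2 + card C" "card (B \<union> C) = card B + card C"
    using sub finAB card by (auto simp: card_Un_disjoint)
  have C1: "card C \<ge> 1"
    using card(2) finAB unfolding C_def by (simp add: Suc_le_eq card_gt_0_iff psubset_imp_ex_mem)
  have nonneg: "0 \<le> sum x W" if "W \<subseteq> V" for W
    using that pos by (intro sum_nonneg) (auto intro: less_imp_le)
  obtain u0 where u0: "u0 \<in> V" using C1 sub by (metis Un_subset_iff card.empty not_one_le_zero subset_empty subsetI)
  have T: "T > 0" unfolding T_def using fin u0 pos by (intro sum_pos) auto
  have "0 < T + of_bool (u0 \<in> A') * sum x (B \<union> C) + of_bool (u0 \<in> B \<union> C) * sum x A'"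
    using T nonneg sub by (intro add_pos_nonneg) auto
  with row[OF u0] pos[OF u0] have L: "L > 0" by (metis zero_less_mult_pos2)
  define \<alpha> where "\<alpha> = (T + sum x (B \<union> C)) / L"
  define \<beta> where "\<beta> = (T + sum x A') / L"
  have "x u = \<alpha>" if "u \<in> A'" for u
  proof -
    have "u \<in> V" "u \<notin> B \<union> C" using that sub by auto
    with row[of u] that have "L * x u = T + sum x (B \<union> C)" by (simp del: Un_iff)
    then show ?thesis unfolding \<alpha>_def using L by (simp add: field_simps)
  qed
  then have xA: "sum x A' = 2 * \<alpha>" using card by simp
  have "x u = \<beta>" if "u \<in> B \<union> C" for u
  proof -
    have "u \<in> V" "u \<notin> A'" using that sub by auto
    with row[of u] that have "L * x u = T + sum x A'" by (simp del: Un_iff)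
    then show ?thesis unfolding \<beta>_def using L by (simp add: field_simps)
  qed
  then have xB: "sum x B = card B * \<beta>" and xC: "sum x C = card C * \<beta>" by simp_all
  have xBC: "sum x (B \<union> C) = sum x B + sum x C" using finAB sub by (simp add: sum.union_disjoint)
  define b c where "b = real (card B)" and "c = real (card C)"
  \<comment> \<open>Here \<open>card A \<le> card B\<close> enters: \<open>A\<close> consists of
    \<open>C\<close> and the two vertices of \<open>A'\<close>. In particular
    \<open>b \<ge> 3\<close>.\<close>
  have bc: "c \<ge> 1" "b \<ge> c + 2" using C1 card cA unfolding b_def c_def by linarith+
  have L\<alpha>: "L * \<alpha> = T + (b + c) * \<beta>"
  proof -
    have "L * \<alpha> = T + sum x (B \<union> C)" using L unfolding \<alpha>_def by simp
    then show ?thesis unfolding xBC xB xC b_def c_def by (simp add: algebra_simps)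
  qed
  have L\<beta>: "L * \<beta> = T + 2 * \<alpha>" using L xA unfolding \<beta>_def by simp
  have \<beta>: "\<beta> > 0" unfolding \<beta>_def using L T nonneg[OF sub(1)] by (intro divide_pos_pos) auto
  \<comment> \<open>The total weight is at least that of \<open>B \<union> C\<close>, which bounds
    \<open>L\<close> below by \<open>b + c\<close>, hence by 4.\<close>
  have "T \<ge> sum x (B \<union> C)" unfolding T_def
    using fin sub pos by (intro sum_mono2) (auto intro: less_imp_le)
  then have "L * \<beta> \<ge> (b + c) * \<beta>"
    using L\<beta> nonneg[OF sub(1)] xA xBC xB xC unfolding b_def c_def by (simp add: algebra_simps)
  then have L4: "L \<ge> b + c" using \<beta> by simp
  \<comment> \<open>Subtracting the two eigenvalue equations eliminates \<open>T\<close> and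
    expresses \<alpha> through \<beta>.\<close>
  have "(L + 2) * (b * \<beta> - 2 * \<alpha>) = \<beta> * (b * (L + 2) - 2 * (L + b + c))"
  proof -
    have "(L + 2) * \<alpha> = (L + b + c) * \<beta>" using L\<alpha> L\<beta> by (simp add: algebra_simps)
    then show ?thesis by (simp add: algebra_simps)
  qed
  also have "\<dots> > 0"
  proof (intro mult_pos_pos \<beta>)
    \<comment> \<open>The target exceeds this product by exactly
      \<open>2 * (b - c - 2)\<close>.\<close>
    have "0 < (b - 2) * (L - 2)" using bc L4 by (intro mult_pos_pos) auto
    also have "\<dots> \<le> b * (L + 2) - 2 * (L + b + c)" using bc by (simp add: algebra_simps)
    finally show "0 < b * (L + 2) - 2 * (L + b + c)" .
  qed
  finally have "b * \<beta> - 2 * \<alpha> > 0" using L by (simp add: zero_less_mult_iff)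
  then have gap: "0 < sum x C * (sum x B - sum x A')"
    using \<beta> bc unfolding xA xB xC b_def c_def by (intro mult_pos_pos) auto
  have xAA: "sum x A = sum x A' + sum x C" using finAB sub by (simp add: sum.union_disjoint)
  show ?thesis
    using gap unfolding C_def[symmetric] quad_form_sep_dist[OF fin AB] quad_form_sep_dist[OF fin sub(1-3)] xAA xBC
    by (simp add: algebra_simps)
qed

section \<open>Distances in digraphs\<close>

context wf_digraph
begin

text \<open>The conversion only cuts cycles out. Hence any walk bounds \<open>graph_dist\<close>
  from above, although the distance is defined through paths.\<close>

lemma length_awalk_to_apath:
  assumes "awalk u p v"
  shows "length (awalk_to_apath p) \<le> length p"
  using assms
proof (induction rule: awalk_to_apath_induct)
  case (path p)
  then have "awalk_to_apath p = p" by (auto simp: awalk_to_apath.simps)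
  then show ?case by simp
next
  case (decomp p q r s)
  have "length (q @ s) \<le> length p"
    by (rule awalk_cyc_decompE[OF decomp(2,1,3)]) auto
  then show ?case using decomp(4) step_awalk_to_apath[OF decomp(1-3)] by simp
qed

lemma graph_dist_le:
  assumes "awalk u p v"
  shows "graph_dist G u v \<le> length p"
proof -
  have "graph_dist G u v \<le> length (awalk_to_apath p)"
    unfolding graph_dist_def by (rule Least_le) (use apath_awalk_to_apath[OF assms] in blast)
  then show ?thesis using length_awalk_to_apath[OF assms] by simp
qed

text \<open>Reachability provides a path, so the \<open>LEAST\<close> in the definition is
  attained.\<close>

lemma graph_dist_awalkE:
  assumes "u \<rightarrow>\<^sup>* v"
  obtains p where "awalk u p v" "length p = graph_dist G u v"
proof -
  have "\<exists>k p. apath u p v \<and> length p = k" using assms by (auto simp: reachable_apath)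
  from LeastI_ex[OF this] that show ?thesis
    unfolding graph_dist_def by (auto dest: awalkI_apath)
qed

lemma graph_dist_self:
  assumes "v \<in> verts G"
  shows "graph_dist G v v = 0"
  using graph_dist_le[of v "[]" v] assms by (simp add: awalk_Nil_iff)

lemma graph_dist_adj:
  assumes "u \<rightarrow> v"
  shows "graph_dist G u v \<le> 1"
proof -
  from assms obtain e where "e \<in> arcs G" "tail G e = u" "head G e = v" by (rule reachableE)
  then have "awalk u [e] v" using arc_implies_awalk by auto
  from graph_dist_le[OF this] show ?thesis by simp
qed

lemma graph_dist_common_neighbour:
  assumes "u \<rightarrow> w" "w \<rightarrow> v"
  shows "graph_dist G u v \<le> 2"
proof -
  obtain e where "e \<in> arcs G" "tail G e = u" "head G e = w" using assms(1) by (rule reachableE)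
  moreover obtain f where "f \<in> arcs G" "tail G f = w" "head G f = v" using assms(2) by (rule reachableE)
  ultimately have "awalk u [e, f] v" by (auto simp: awalk_simps)
  from graph_dist_le[OF this] show ?thesis by simp
qed

lemma graph_dist_ge_1:
  assumes "u \<rightarrow>\<^sup>* v" "u \<noteq> v"
  shows "1 \<le> graph_dist G u v"
proof -
  obtain p where "awalk u p v" "length p = graph_dist G u v"
    using graph_dist_awalkE[OF assms(1)] .
  then show ?thesis using assms(2) by (cases p) (auto simp: awalk_simps)
qed

lemma graph_dist_ge_2:
  assumes "u \<rightarrow>\<^sup>* v" "u \<noteq> v" "\<not> u \<rightarrow> v"
  shows "2 \<le> graph_dist G u v"
proof (rule ccontr)
  assume "\<not> ?thesis"
  with graph_dist_ge_1[OF assms(1,2)] have 1: "graph_dist G u v = 1" by simp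
  obtain p where p: "awalk u p v" "length p = graph_dist G u v"
    using graph_dist_awalkE[OF assms(1)] .
  with 1 obtain e where "p = [e]" by (auto simp: length_Suc_conv)
  with p have "e \<in> arcs G" "tail G e = u" "head G e = v" by (auto simp: awalk_simps)
  then have "u \<rightarrow> v" using in_arcs_imp_in_arcs_ends by force
  with assms show False by simp
qed

end

text \<open>Each arc is replaced by an opposite arc, in reverse order. This yields symmetry of the
  distance.\<close>

lemma (in sym_digraph) awalk_reverse:
  assumes "awalk u p v"
  shows "\<exists>q. awalk v q u \<and> length q = length p"
  using assms
proof (induction p arbitrary: u)
  case Nil
  then show ?case by (auto simp: awalk_Nil_iff)
next
  case (Cons e p)
  then have e: "e \<in> arcs G" "u = tail G e" "awalk (head G e) p v" by (auto simp: awalk_Cons_iff)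
  with Cons.IH obtain q where q: "awalk v q (head G e)" "length q = length p" by blast
  from e sym_arcs obtain e' where "e' \<in> arcs G" "tail G e' = head G e" "head G e' = tail G e"
    unfolding symmetric_conv by force
  then have "awalk (head G e) [e'] u" using e(2) arc_implies_awalk[of e'] by simp
  with q(1) have "awalk v (q @ [e']) u" by (rule awalk_appendI)
  then show ?case using q by (intro exI[of _ "q @ [e']"]) simp
qed

lemma (in sym_digraph) graph_dist_commute:
  assumes "u \<rightarrow>\<^sup>* v"
  shows "graph_dist G u v = graph_dist G v u"
proof -
  have le: "graph_dist G y x \<le> graph_dist G x y" if xy: "x \<rightarrow>\<^sup>* y" for x y
  proof -
    obtain p where p: "awalk x p y" "length p = graph_dist G x y"
      using graph_dist_awalkE[OF xy] .
    obtain q where "awalk y q x" "length q = length p" using awalk_reverse[OF p(1)] by blast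
    then show ?thesis using graph_dist_le[of y q x] p(2) by simp
  qed
  show ?thesis using le[OF assms] le[OF symmetric_reachable'[OF assms]] by simp
qed

text \<open>Walks transfer along the isomorphism in both directions with their length, giving one
  inequality each way.\<close>

lemma (in wf_digraph) graph_dist_app_iso:
  assumes hom: "digraph_isomorphism \<phi>" and uv: "u \<in> verts G" "v \<in> verts G" "u \<rightarrow>\<^sup>* v"
  shows "graph_dist (app_iso \<phi> G) (iso_verts \<phi> u) (iso_verts \<phi> v) = graph_dist G u v"
proof -
  interpret I: wf_digraph "app_iso \<phi> G" using hom ..
  have reach: "iso_verts \<phi> u \<rightarrow>\<^sup>*\<^bsub>app_iso \<phi> G\<^esub> iso_verts \<phi> v"
    using uv(3) hom by (rule reachableI_app_iso)
  show ?thesis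
  proof (rule antisym)
    obtain p where p: "awalk u p v" "length p = graph_dist G u v"
      using graph_dist_awalkE[OF uv(3)] .
    then show "graph_dist (app_iso \<phi> G) (iso_verts \<phi> u) (iso_verts \<phi> v) \<le> graph_dist G u v"
      using I.graph_dist_le[OF awalk_app_isoI[OF p(1) hom]] by simp
    obtain p where p: "I.awalk (iso_verts \<phi> u) p (iso_verts \<phi> v)"
      "length p = graph_dist (app_iso \<phi> G) (iso_verts \<phi> u) (iso_verts \<phi> v)"
      using I.graph_dist_awalkE[OF reach] .
    then show "graph_dist G u v \<le> graph_dist (app_iso \<phi> G) (iso_verts \<phi> u) (iso_verts \<phi> v)"
      using graph_dist_le[OF awalk_app_isoD[OF p(1) hom]] hom uv by simp
  qed
qed

section \<open>Spectra of distance matrices\<close>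

lemma eigenpair_on_reindex:
  assumes bij: "bij_betw \<phi> V W"
    and d: "\<And>u v. u \<in> V \<Longrightarrow> v \<in> V \<Longrightarrow> d u v = e (\<phi> u) (\<phi> v)"
  shows "eigenpair_on V d \<mu> (y \<circ> \<phi>) \<longleftrightarrow> eigenpair_on W e \<mu> y"
proof -
  have W: "W = \<phi> ` V" using bij by (simp add: bij_betw_def)
  have "(\<Sum>v\<in>V. d u v * (y \<circ> \<phi>) v) = (\<Sum>w\<in>W. e (\<phi> u) w * y w)" if "u \<in> V" for u
  proof -
    have "(\<Sum>v\<in>V. d u v * (y \<circ> \<phi>) v) = (\<Sum>v\<in>V. e (\<phi> u) (\<phi> v) * y (\<phi> v))"
      using d that by simp
    then show ?thesis using sum.reindex_bij_betw[OF bij, of "\<lambda>w. e (\<phi> u) w * y w"] by simp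
  qed
  then show ?thesis unfolding eigenpair_on_def W by simp
qed

lemma eigenpair_on_cong:
  assumes "\<And>v. v \<in> V \<Longrightarrow> f v = g v" "\<And>u v. u \<in> V \<Longrightarrow> v \<in> V \<Longrightarrow> d u v = e u v"
  shows "eigenpair_on V d \<mu> f \<longleftrightarrow> eigenpair_on V e \<mu> g"
  unfolding eigenpair_on_def using assms by (simp cong: sum.cong)

text \<open>An eigenfunction on \<open>V\<close> moves to \<open>W\<close> through the inverse of
  \<phi>; agreement on \<open>V\<close> suffices because values elsewhere do not enter the
  equation.\<close>

lemma ex_eigenpair_on_reindex:
  assumes bij: "bij_betw \<phi> V W"
    and d: "\<And>u v. u \<in> V \<Longrightarrow> v \<in> V \<Longrightarrow> d u v = e (\<phi> u) (\<phi> v)"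
  shows "(\<exists>x. eigenpair_on V d \<mu> x) \<longleftrightarrow> (\<exists>y. eigenpair_on W e \<mu> y)"
proof
  assume "\<exists>x. eigenpair_on V d \<mu> x"
  then obtain x where "eigenpair_on V d \<mu> x" by blast
  moreover have "\<And>v. v \<in> V \<Longrightarrow> x v = (x \<circ> the_inv_into V \<phi> \<circ> \<phi>) v"
    using bij by (simp add: bij_betw_def the_inv_into_f_f)
  ultimately have "eigenpair_on V d \<mu> (x \<circ> the_inv_into V \<phi> \<circ> \<phi>)"
    using eigenpair_on_cong[of V x "x \<circ> the_inv_into V \<phi> \<circ> \<phi>" d d] by blast
  then show "\<exists>y. eigenpair_on W e \<mu> y"
    using eigenpair_on_reindex[of \<phi> V W d e, OF bij d] by blast
next
  assume "\<exists>y. eigenpair_on W e \<mu> y"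
  then show "\<exists>x. eigenpair_on V d \<mu> x" using eigenpair_on_reindex[of \<phi> V W d e, OF bij d] by blast
qed

lemma (in graph) reachable_if_connected:
  assumes "Digraph_Component.connected G" "u \<in> verts G" "v \<in> verts G"
  shows "u \<rightarrow>\<^sup>* v"
  using symmetric_connected_imp_strongly_connected[OF sym_arcs assms(1)] assms(2,3)
  by (simp add: strongly_connected_def)

text \<open>This recovers a graph from its distances, which turns equality of distances into an
  isomorphism in the equality case.\<close>

lemma (in graph) graph_dist_conv_adj:
  assumes con: "Digraph_Component.connected G" and uv: "u \<in> verts G" "v \<in> verts G"
  shows "u \<rightarrow> v \<longleftrightarrow> graph_dist G u v = 1"
proof -
  have r: "u \<rightarrow>\<^sup>* v" by (rule reachable_if_connected[OF con uv])
  show ?thesis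
  proof
    assume a: "u \<rightarrow> v"
    then have "u \<noteq> v" using adj_not_same by blast
    from graph_dist_ge_1[OF r this] graph_dist_adj[OF a] show "graph_dist G u v = 1" by simp
  next
    assume d: "graph_dist G u v = 1"
    then have "u \<noteq> v" using graph_dist_self[OF uv(1)] by auto
    with graph_dist_ge_2[OF r] d show "u \<rightarrow> v" by fastforce
  qed
qed

text \<open>An isomorphism preserves distances, so the two spectra coincide as sets. This is the
  easy direction of the equality statement.\<close>

lemma (in graph) largest_eigenvalue_distance_matrix_iso:
  assumes con: "Digraph_Component.connected G" and iso: "digraph_iso G H"
  shows "largest_eigenvalue (distance_matrix G) = largest_eigenvalue (distance_matrix H)"
proof -
  obtain f where f: "digraph_isomorphism f" and H: "H = app_iso f G"
    using iso unfolding digraph_iso_def by blast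
  have bij: "bij_betw (iso_verts f) (verts G) (verts H)"
    unfolding H bij_betw_def using digraph_isomorphism_inj_on_verts[OF f] by simp
  have "finite (verts H)" unfolding H by simp
  moreover have "distance_on G u v = distance_on H (iso_verts f u) (iso_verts f v)"
    if "u \<in> verts G" "v \<in> verts G" for u v
    unfolding H using graph_dist_app_iso[OF f that reachable_if_connected[OF con that]] by simp
  ultimately have "spectrum (distance_matrix G) = spectrum (distance_matrix H)"
    using ex_eigenpair_on_reindex[OF bij, of "distance_on G" "distance_on H"]
    by (simp add: spectrum_distance_matrix)
  then show ?thesis unfolding largest_eigenvalue_def by simp
qed

text \<open>Connectedness makes the distance symmetric and positive off the diagonal, so
  \<open>perron\<close> applies, and its \<open>M\<close> is the largest eigenvalue.\<close>

lemma (in graph) perron_distance_matrix: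
  assumes con: "Digraph_Component.connected G"
  obtains x where
    "eigenpair_on (verts G) (distance_on G) (largest_eigenvalue (distance_matrix G)) x"
    "\<forall>v\<in>verts G. 0 < x v"
    "\<forall>f. quad_form (verts G) (distance_on G) f
      \<le> largest_eigenvalue (distance_matrix G) * (\<Sum>v\<in>verts G. (f v)\<^sup>2)"
proof -
  note reach = reachable_if_connected[OF con]
  have ne: "verts G \<noteq> {}"
    using symmetric_connected_imp_strongly_connected[OF sym_arcs con]
    by (simp add: strongly_connected_def)
  have "distance_on G u v = distance_on G v u" if "u \<in> verts G" "v \<in> verts G" for u v
    using graph_dist_commute[OF reach[OF that]] by simp
  moreover have "0 < distance_on G u v" if "u \<in> verts G" "v \<in> verts G" "u \<noteq> v" for u v
    using graph_dist_ge_1[OF reach[OF that(1,2)] that(3)] by simp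
  ultimately obtain M x where M: "eigenpair_on (verts G) (distance_on G) M x"
    "\<And>v. v \<in> verts G \<Longrightarrow> 0 < x v"
    "\<And>f. quad_form (verts G) (distance_on G) f \<le> M * (\<Sum>v\<in>verts G. (f v)\<^sup>2)"
    using perron[OF finite_verts ne, of "distance_on G"] by (smt (verit) of_nat_0_le_iff)
  have "largest_eigenvalue (distance_matrix G) = M"
    by (rule largest_eigenvalue_distance_matrixI[OF finite_verts M(1,3)])
  with M that show ?thesis by blast
qed

section \<open>Essential vertex-cuts and the extremal graph\<close>

text \<open>One side is a non-trivial component, the other is the rest of \<open>G - S\<close>,
  which contains a second one. Each side contains both ends of an edge, and an edge between the
  sides would put its ends into the same component.\<close>

lemma (in graph) essential_vertex_cutE:
  assumes "essential_vertex_cut G S"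
  obtains A B where "A \<union> B = verts G - S" "A \<inter> B = {}" "2 \<le> card A" "card A \<le> card B"
    "\<forall>u\<in>A. \<forall>v\<in>B. \<not> u \<rightarrow> v"
proof -
  define F where "F = delete_vertices G S"
  have ind: "induced_subgraph F G" unfolding F_def delete_vertices_def by (rule induced_induce) auto
  interpret F: wf_digraph F using ind by (auto simp: induced_subgraph_def subgraph_def)
  have verts_F: "verts F = verts G - S" unfolding F_def delete_vertices_def by simp
  from assms obtain C D where CD: "C \<in> F.sccs" "D \<in> F.sccs" "C \<noteq> D"
    and nt: "nontrivial_graph C" "nontrivial_graph D"
    unfolding essential_vertex_cut_def F_def by blast
  have sub: "verts C \<subseteq> verts F" "2 \<le> card (verts C)"
    if C: "C \<in> F.sccs" and nt: "nontrivial_graph C" for C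
  proof -
    have "subgraph C F" using C by (auto dest: F.in_sccs_imp_induced induced_imp_subgraph)
    then interpret C: wf_digraph C by (auto simp: subgraph_def)
    show sub: "verts C \<subseteq> verts F" using \<open>subgraph C F\<close> by (auto simp: subgraph_def)
    obtain e where e: "e \<in> arcs C" "tail C e \<noteq> head C e" using nt unfolding nontrivial_graph_def by blast
    then have "{tail C e, head C e} \<subseteq> verts C" by auto
    moreover have "finite (verts C)" using sub verts_F finite_verts by (metis finite_Diff finite_subset)
    ultimately have "card {tail C e, head C e} \<le> card (verts C)" by (intro card_mono)
    then show "2 \<le> card (verts C)" using e by simp
  qed
  define X where "X = verts C"
  define Y where "Y = verts G - S - X"
  have finXY: "finite X" "finite Y"
    using sub(1)[OF CD(1) nt(1)] verts_F finite_verts unfolding X_def Y_def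
    by (metis finite_Diff finite_subset)+
  have "verts D \<subseteq> Y"
    using sub(1)[OF CD(2) nt(2)] F.scc_disj[OF CD] verts_F unfolding X_def Y_def by blast
  then have cards: "2 \<le> card X" "2 \<le> card Y"
    using sub(2)[OF CD(1) nt(1)] sub(2)[OF CD(2) nt(2)] card_mono[OF finXY(2), of "verts D"]
    unfolding X_def by linarith+
  have XY: "X \<union> Y = verts G - S" "X \<inter> Y = {}"
    using sub(1)[OF CD(1) nt(1)] verts_F unfolding X_def Y_def by auto
  have X: "X \<in> F.sccs_verts" unfolding X_def using CD by (intro F.in_sccs_vertsI_sccs) auto
  have adj: "u \<rightarrow>\<^bsub>F\<^esub> v" if uv: "u \<rightarrow> v" "u \<in> verts F" "v \<in> verts F" for u v
  proof -
    obtain e where "e \<in> arcs G" "tail G e = u" "head G e = v" using uv(1) by (rule reachableE)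
    then show ?thesis using uv(2,3) verts_F
      unfolding F_def delete_vertices_def by (auto simp: arcs_ends_conv)
  qed
  \<comment> \<open>Both directions are recorded because either \<open>X\<close> or \<open>Y\<close>
    may be the smaller side.\<close>
  have sep: "\<not> u \<rightarrow> v" "\<not> v \<rightarrow> u" if "u \<in> X" "v \<in> Y" for u v
  proof -
    have uv: "u \<in> verts F" "v \<in> verts F" using that XY verts_F by auto
    show "\<not> u \<rightarrow> v"
    proof
      assume "u \<rightarrow> v"
      then have "v \<rightarrow> u" by (rule arcs_ends_symmetric[OF sym_arcs])
      with \<open>u \<rightarrow> v\<close> adj uv have "u \<rightarrow>\<^sup>*\<^bsub>F\<^esub> v" "v \<rightarrow>\<^sup>*\<^bsub>F\<^esub> u" by auto
      moreover have "v \<notin> X" using that XY by auto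
      ultimately show False using X that(1) unfolding F.in_sccs_verts_conv_reachable by blast
    qed
    then show "\<not> v \<rightarrow> u" using arcs_ends_symmetric[OF sym_arcs] by blast
  qed
  show ?thesis
  proof (cases "card X \<le> card Y")
    case True
    with that[of X Y] XY cards sep show ?thesis by simp
  next
    case False
    moreover have "Y \<union> X = verts G - S" "Y \<inter> X = {}" using XY by auto
    ultimately show ?thesis using that[of Y X] cards sep by simp
  qed
qed

text \<open>Deleting no vertex leaves the connected graph \<open>G\<close>. Nonemptiness provides a
  vertex in the complete part of the join.\<close>

lemma (in graph) essential_vertex_cut_nonempty:
  assumes "Digraph_Component.connected G" "essential_vertex_cut G S"
  shows "S \<noteq> {}"
proof
  assume "S = {}"
  have "delete_vertices G {} = G"
    unfolding delete_vertices_def by (rule pre_digraph.equality) auto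
  with assms \<open>S = {}\<close> show False unfolding essential_vertex_cut_def by simp
qed

text \<open>Distinct vertices are at distance at least 1, nonadjacent ones at least 2, and pairs
  split between \<open>A\<close> and \<open>B\<close> are nonadjacent.\<close>

lemma (in graph) sep_dist_le_graph_dist:
  assumes con: "Digraph_Component.connected G"
    and sep: "\<And>u v. u \<in> A \<Longrightarrow> v \<in> B \<Longrightarrow> \<not> u \<rightarrow> v"
    and uv: "u \<in> verts G" "v \<in> verts G"
  shows "sep_dist A B u v \<le> distance_on G u v"
proof -
  have reach: "u \<rightarrow>\<^sup>* v" by (rule reachable_if_connected[OF con uv])
  have "\<not> v \<rightarrow> u \<Longrightarrow> \<not> u \<rightarrow> v" using arcs_ends_symmetric[OF sym_arcs] by blast
  then have "\<not> u \<rightarrow> v" if "u \<in> A \<and> v \<in> B \<or> u \<in> B \<and> v \<in> A" using sep that by blast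
  then show ?thesis
    using graph_dist_ge_1[OF reach] graph_dist_ge_2[OF reach] unfolding sep_dist_def by auto
qed

text \<open>The vertex \<open>w\<close> is adjacent to all others, so it is a common neighbour of
  every nonadjacent pair of distinct vertices.\<close>

lemma (in wf_digraph) graph_dist_eq_sep_dist:
  assumes adj: "\<And>u v. u \<in> verts G \<Longrightarrow> v \<in> verts G \<Longrightarrow>
      u \<rightarrow> v \<longleftrightarrow> u \<noteq> v \<and> \<not> (u \<in> A \<and> v \<in> B \<or> u \<in> B \<and> v \<in> A)"
    and AB: "A \<inter> B = {}"
    and w: "w \<in> verts G" "w \<notin> A" "w \<notin> B"
    and uv: "u \<in> verts G" "v \<in> verts G"
  shows "u \<rightarrow>\<^sup>* v" "distance_on G u v = sep_dist A B u v"
proof -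
  consider "u = v" | "u \<noteq> v" "u \<rightarrow> v" | "u \<noteq> v" "\<not> u \<rightarrow> v" by blast
  then have "u \<rightarrow>\<^sup>* v \<and> distance_on G u v = sep_dist A B u v"
  proof cases
    case 1
    then show ?thesis using uv by (simp add: graph_dist_self sep_dist_def)
  next
    case 2
    then have r: "u \<rightarrow>\<^sup>* v" by auto
    then have "graph_dist G u v = 1"
      using graph_dist_adj[OF 2(2)] graph_dist_ge_1[OF r 2(1)] by simp
    with r 2 adj[OF uv] show ?thesis by (auto simp: sep_dist_def)
  next
    case 3
    then have sep: "u \<in> A \<and> v \<in> B \<or> u \<in> B \<and> v \<in> A" using adj[OF uv] by blast
    then have "u \<rightarrow> w" "w \<rightarrow> v" using adj[OF uv(1) w(1)] adj[OF w(1) uv(2)] w by auto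
    then have r: "u \<rightarrow>\<^sup>* v" by (meson adj_reachable_trans reachable_adjI)
    have "graph_dist G u v = 2"
      using graph_dist_common_neighbour[OF \<open>u \<rightarrow> w\<close> \<open>w \<rightarrow> v\<close>] graph_dist_ge_2[OF r 3] by simp
    with r 3 sep show ?thesis by (auto simp: sep_dist_def)
  qed
  then show "u \<rightarrow>\<^sup>* v" "distance_on G u v = sep_dist A B u v" by auto
qed

text \<open>Without parallel arcs an arc is determined by its ends, so \<phi> extends to arcs by
  sending each arc to the pair of images of its ends.\<close>

lemma (in nomulti_digraph) digraph_iso_with_projI:
  assumes P: "wf_digraph (with_proj P)"
    and bij: "bij_betw \<phi> (verts G) (pverts P)"
    and adj: "\<And>u v. u \<in> verts G \<Longrightarrow> v \<in> verts G \<Longrightarrow> u \<rightarrow> v \<longleftrightarrow> (\<phi> u, \<phi> v) \<in> parcs P"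
  shows "digraph_iso G (with_proj P)"
proof -
  define h where "h = \<lparr>iso_verts = \<phi>, iso_arcs = \<lambda>e. (\<phi> (tail G e), \<phi> (head G e)),
    iso_head = snd, iso_tail = fst\<rparr>"
  have inj: "inj_on \<phi> (verts G)" and img: "\<phi> ` verts G = pverts P"
    using bij by (auto simp: bij_betw_def)
  have "inj_on (iso_arcs h) (arcs G)"
  proof (rule inj_onI)
    fix e e' assume e: "e \<in> arcs G" "e' \<in> arcs G" and "iso_arcs h e = iso_arcs h e'"
    then have "tail G e = tail G e'" "head G e = head G e'"
      using inj by (auto simp: h_def dest: inj_onD)
    with e show "e = e'" by (intro no_multi_arcs) (simp_all add: arc_to_ends_def)
  qed
  then have "digraph_isomorphism h"
    using inj wf_digraph by (simp add: digraph_isomorphism_def h_def)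
  moreover have "iso_arcs h ` arcs G = parcs P"
  proof
    show "iso_arcs h ` arcs G \<subseteq> parcs P"
      using adj in_arcs_imp_in_arcs_ends by (auto simp: h_def)
    show "parcs P \<subseteq> iso_arcs h ` arcs G"
    proof
      fix a assume a: "a \<in> parcs P"
      then have "fst a \<in> pverts P" "snd a \<in> pverts P"
        using wf_digraph.tail_in_verts[OF P, of a] wf_digraph.head_in_verts[OF P, of a] by auto
      then obtain u v where uv: "u \<in> verts G" "v \<in> verts G" "a = (\<phi> u, \<phi> v)"
        using img by (metis imageE prod.collapse)
      with a adj have "u \<rightarrow> v" by blast
      then obtain e where "e \<in> arcs G" "tail G e = u" "head G e = v" by (rule reachableE)
      with uv show "a \<in> iso_arcs h ` arcs G" by (auto simp: h_def)
    qed
  qed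
  ultimately have "with_proj P = app_iso h G"
    using img by (simp add: app_iso_def with_proj_def h_def)
  with \<open>digraph_isomorphism h\<close> show ?thesis unfolding digraph_iso_def by blast
qed

abbreviation (input) "extremal_graph k m \<equiv>
  join_graph (complete_graph k) (disjoint_union (complete_graph 2) (complete_graph m))"

lemma pair_graph_extremal_graph: "pair_graph (extremal_graph k m)"
  by (intro pair_graph_join_graph pair_graph_disjoint_union pair_graph_complete_graph)

text \<open>The nested sums are flattened into three blocks, and adjacency takes the form that
  \<open>graph_dist_eq_sep_dist\<close> expects.\<close>

lemma extremal_graph_simps:
  "pverts (extremal_graph k m) = Inl ` {..<k} \<union> Inr ` Inl ` {..<2} \<union> Inr ` Inr ` {..<m}"
  "(u, v) \<in> parcs (extremal_graph k m) \<longleftrightarrow>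
    u \<in> pverts (extremal_graph k m) \<and> v \<in> pverts (extremal_graph k m) \<and> u \<noteq> v \<and>
    \<not> (u \<in> Inr ` Inl ` {..<2} \<and> v \<in> Inr ` Inr ` {..<m} \<or>
       u \<in> Inr ` Inr ` {..<m} \<and> v \<in> Inr ` Inl ` {..<2})"
  by (auto simp: join_graph_def disjoint_union_def complete_graph_def image_iff)

text \<open>Bijections of the three blocks are glued together. The two membership clauses ensure
  that \<phi> transports \<open>sep_dist\<close>.\<close>

lemma extremal_graph_bijection:
  assumes fin: "finite S" "finite A" "finite B"
    and card: "card S = k" "card A = 2" "card B = m"
    and disj: "S \<inter> A = {}" "S \<inter> B = {}" "A \<inter> B = {}"
  obtains \<phi> where "bij_betw \<phi> (S \<union> A \<union> B) (pverts (extremal_graph k m))"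
    "\<forall>v\<in>S \<union> A \<union> B. \<phi> v \<in> Inr ` Inl ` {..<2} \<longleftrightarrow> v \<in> A"
    "\<forall>v\<in>S \<union> A \<union> B. \<phi> v \<in> Inr ` Inr ` {..<m} \<longleftrightarrow> v \<in> B"
proof -
  obtain f g h where fgh: "bij_betw f S {..<k}" "bij_betw g A {..<2::nat}" "bij_betw h B {..<m}"
    using finite_same_card_bij[OF fin(1), of "{..<k}"] finite_same_card_bij[OF fin(2), of "{..<2::nat}"]
      finite_same_card_bij[OF fin(3), of "{..<m}"] card by auto
  define \<phi> where "\<phi> v = (if v \<in> S then Inl (f v) else if v \<in> A then Inr (Inl (g v)) else Inr (Inr (h v)))" for v
  have img: "f ` S = {..<k}" "g ` A = {..<2}" "h ` B = {..<m}"
    and inj: "inj_on f S" "inj_on g A" "inj_on h B"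
    using fgh by (auto simp: bij_betw_def)
  have S: "\<phi> v = Inl (f v)" if "v \<in> S" for v using that by (simp add: \<phi>_def)
  have A: "\<phi> v = Inr (Inl (g v))" if "v \<in> A" for v using that disj by (auto simp: \<phi>_def)
  have B: "\<phi> v = Inr (Inr (h v))" if "v \<in> B" for v using that disj by (auto simp: \<phi>_def)
  have memA: "g v < 2" if "v \<in> A" for v using img(2) that by blast
  have memB: "h v < m" if "v \<in> B" for v using img(3) that by blast
  show ?thesis
  proof (rule that)
    have "\<phi> ` S = Inl ` f ` S" "\<phi> ` A = Inr ` Inl ` g ` A" "\<phi> ` B = Inr ` Inr ` h ` B"
      unfolding image_image by (intro image_cong refl S A B; assumption)+
    then have "\<phi> ` (S \<union> A \<union> B) = pverts (extremal_graph k m)"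
      unfolding extremal_graph_simps image_Un img by simp
    moreover have "inj_on \<phi> (S \<union> A \<union> B)"
    proof (rule inj_onI)
      fix u v assume "u \<in> S \<union> A \<union> B" "v \<in> S \<union> A \<union> B" "\<phi> u = \<phi> v"
      then show "u = v" by (elim UnE) (simp_all add: S A B inj[THEN inj_on_eq_iff])
    qed
    ultimately show "bij_betw \<phi> (S \<union> A \<union> B) (pverts (extremal_graph k m))"
      unfolding bij_betw_def by simp
    show "\<forall>v\<in>S \<union> A \<union> B. \<phi> v \<in> Inr ` Inl ` {..<2} \<longleftrightarrow> v \<in> A"
      by (intro ballI, elim UnE) (use disj memA in \<open>auto simp: S A B\<close>)
    show "\<forall>v\<in>S \<union> A \<union> B. \<phi> v \<in> Inr ` Inr ` {..<m} \<longleftrightarrow> v \<in> B"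
      by (intro ballI, elim UnE) (use disj memB in \<open>auto simp: S A B\<close>)
  qed
qed

theorem theorem1:
  fixes G :: "('a, 'b) pre_digraph" and \<kappa> n :: nat
  assumes "graph G"
    and "Digraph_Component.connected G"
    and "\<exists>S. essential_vertex_cut G S"
    and "essential_connectivity G = \<kappa>"
    and "card (verts G) = n"
    and "n \<ge> \<kappa> + 4"
  defines "H \<equiv> with_proj (join_graph (complete_graph \<kappa>)
                 (disjoint_union (complete_graph 2) (complete_graph (n - \<kappa> - 2))))"
  shows "largest_eigenvalue (distance_matrix G) \<ge> largest_eigenvalue (distance_matrix H)
       \<and> (largest_eigenvalue (distance_matrix G) = largest_eigenvalue (distance_matrix H)
            \<longleftrightarrow> digraph_iso G H)"
proof -
  interpret graph G by fact
  note con = \<open>Digraph_Component.connected G\<close>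
  let ?V = "verts G"
  let ?m = "n - \<kappa> - 2"
  let ?lG = "largest_eigenvalue (distance_matrix G)"
  let ?lH = "largest_eigenvalue (distance_matrix H)"

  \<comment> \<open>A minimum cut and the partition it induces\<close>
  have "\<exists>k S. essential_vertex_cut G S \<and> card S = k" using assms(3) by blast
  then have "\<exists>S. essential_vertex_cut G S \<and> card S = essential_connectivity G"
    unfolding essential_connectivity_def by (rule LeastI_ex)
  then obtain S where S: "essential_vertex_cut G S" "card S = \<kappa>" using assms(4) by blast
  have SV: "S \<subseteq> ?V" using S(1) unfolding essential_vertex_cut_def by blast
  obtain A B where AB: "A \<union> B = ?V - S" "A \<inter> B = {}" "2 \<le> card A" "card A \<le> card B"
    and "\<forall>u\<in>A. \<forall>v\<in>B. \<not> u \<rightarrow>\<^bsub>G\<^esub> v"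
    by (rule essential_vertex_cutE[OF S(1)])
  then have sep: "\<And>u v. u \<in> A \<Longrightarrow> v \<in> B \<Longrightarrow> \<not> u \<rightarrow>\<^bsub>G\<^esub> v" by blast
  obtain A' where A': "A' \<subseteq> A" "card A' = 2" by (rule obtain_subset_with_card_n[OF AB(3)])
  define B' where "B' = B \<union> (A - A')"
  have V: "S \<union> A' \<union> B' = ?V" and disj: "S \<inter> A' = {}" "S \<inter> B' = {}" "A' \<inter> B' = {}"
    and sub: "A \<subseteq> ?V" "B \<subseteq> ?V"
    using AB(1,2) A'(1) SV unfolding B'_def by blast+
  have fin: "finite S" "finite A'" "finite B'"
    using finite_verts unfolding V[symmetric] by simp_all
  have "card (S \<union> A' \<union> B') = card (S \<union> A') + card B'"
    using fin disj by (intro card_Un_disjoint) auto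
  then have "n = \<kappa> + 2 + card B'"
    using assms(5) S(2) A'(2) fin disj unfolding V by (simp add: card_Un_disjoint)
  then have cB': "card B' = ?m" by simp
  obtain \<phi> where bij: "bij_betw \<phi> (S \<union> A' \<union> B') (pverts (extremal_graph \<kappa> ?m))"
    and \<phi>A: "\<forall>v\<in>S \<union> A' \<union> B'. \<phi> v \<in> Inr ` Inl ` {..<2} \<longleftrightarrow> v \<in> A'"
    and \<phi>B: "\<forall>v\<in>S \<union> A' \<union> B'. \<phi> v \<in> Inr ` Inr ` {..<?m} \<longleftrightarrow> v \<in> B'"
    by (rule extremal_graph_bijection[OF fin S(2) A'(2) cB' disj])
  have bij: "bij_betw \<phi> ?V (verts H)" using bij unfolding V H_def by simp
  have \<phi>V: "\<phi> v \<in> pverts (extremal_graph \<kappa> ?m)" if "v \<in> ?V" for v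
    using bij that unfolding H_def by (auto dest: bij_betwE)
  have \<phi>_inj: "\<phi> u = \<phi> v \<longleftrightarrow> u = v" if "u \<in> ?V" "v \<in> ?V" for u v
    using bij that by (auto simp: bij_betw_def dest: inj_onD)

  \<comment> \<open>Distances in the extremal graph\<close>
  interpret P: pair_graph "extremal_graph \<kappa> ?m" by (rule pair_graph_extremal_graph)
  have "graph H" unfolding H_def by unfold_locales
  then interpret H: graph H .
  \<comment> \<open>A nonempty join part gives \<open>H\<close> the vertex \<open>Inl 0\<close>
    adjacent to all others, which keeps all its distances at most 2.\<close>
  have "\<kappa> \<noteq> 0"
    using S(2) fin(1) essential_vertex_cut_nonempty[OF con S(1)] by auto
  then have w: "Inl 0 \<in> verts H" unfolding H_def by (simp add: extremal_graph_simps)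
  have adjH: "u \<rightarrow>\<^bsub>H\<^esub> v \<longleftrightarrow> u \<noteq> v \<and> \<not> (u \<in> Inr ` Inl ` {..<2} \<and> v \<in> Inr ` Inr ` {..<?m}
      \<or> u \<in> Inr ` Inr ` {..<?m} \<and> v \<in> Inr ` Inl ` {..<2})" if "u \<in> verts H" "v \<in> verts H" for u v
    using that unfolding H_def by (simp add: extremal_graph_simps(2))
  have distH: "u \<rightarrow>\<^sup>*\<^bsub>H\<^esub> v"
    "distance_on H u v = sep_dist (Inr ` Inl ` {..<2}) (Inr ` Inr ` {..<?m}) u v"
    if uv: "u \<in> verts H" "v \<in> verts H" for u v
  proof -
    have "Inr ` Inl ` {..<2} \<inter> Inr ` Inr ` {..<?m} = ({} :: (nat + nat + nat) set)" by auto
    moreover have "(Inl 0 :: nat + nat + nat) \<notin> Inr ` Inl ` {..<2}"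
      "(Inl 0 :: nat + nat + nat) \<notin> Inr ` Inr ` {..<?m}" by auto
    ultimately show "u \<rightarrow>\<^sup>*\<^bsub>H\<^esub> v"
      "distance_on H u v = sep_dist (Inr ` Inl ` {..<2}) (Inr ` Inr ` {..<?m}) u v"
      using H.graph_dist_eq_sep_dist[OF adjH _ w _ _ uv] by blast+
  qed
  have conH: "Digraph_Component.connected H"
    by (rule H.connectedI) (use w distH(1) H.reachable_mk_symmetricI in auto)
  \<comment> \<open>Distances of \<open>H\<close> are pulled back to the vertices of
    \<open>G\<close>, so that both forms live on the same set.\<close>
  have dist\<phi>: "sep_dist A' B' u v = distance_on H (\<phi> u) (\<phi> v)" if "u \<in> ?V" "v \<in> ?V" for u v
  proof -
    have "\<phi> u \<in> verts H" "\<phi> v \<in> verts H" using bij that by (auto dest: bij_betwE)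
    then show ?thesis
      using that \<phi>A \<phi>B \<phi>_inj[OF that] unfolding V by (simp add: distH(2) sep_dist_def)
  qed

  \<comment> \<open>Comparison of Rayleigh quotients\<close>
  obtain y where y: "eigenpair_on (verts H) (distance_on H) ?lH y" "\<forall>v\<in>verts H. 0 < y v"
    by (rule H.perron_distance_matrix[OF conH])
  define x where "x = y \<circ> \<phi>"
  have eig: "eigenpair_on ?V (sep_dist A' B') ?lH x"
    unfolding x_def using y(1) eigenpair_on_reindex[OF bij, of "sep_dist A' B'" "distance_on H"] dist\<phi>
    by blast
  have pos: "0 < x v" if "v \<in> ?V" for v
    unfolding x_def using y(2) bij_betwE[OF bij] that by simp
  have bound: "quad_form ?V (distance_on G) x \<le> ?lG * (\<Sum>v\<in>?V. (x v)\<^sup>2)"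
    by (rule perron_distance_matrix[OF con]) simp
  have le: "sep_dist A B u v \<le> distance_on G u v" if "u \<in> ?V" "v \<in> ?V" for u v
    using sep_dist_le_graph_dist[OF con _ that] sep by blast
  \<comment> \<open>Strictness is kept alongside the inequality because it forces
    \<open>A' = A\<close> in the equality case.\<close>
  have step: "quad_form ?V (sep_dist A' B') x \<le> quad_form ?V (sep_dist A B) x \<and>
    (A' \<noteq> A \<longrightarrow> quad_form ?V (sep_dist A' B') x < quad_form ?V (sep_dist A B) x)"
  proof (cases "A' = A")
    case True
    then show ?thesis by (simp add: B'_def)
  next
    case False
    then have "A' \<subset> A" using A' by blast
    have "quad_form ?V (sep_dist A' B') x < quad_form ?V (sep_dist A B) x"
      unfolding B'_def
      by (rule quad_form_sep_dist_less[OF finite_verts sub AB(2,4) \<open>A' \<subset> A\<close> A'(2) pos])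
        (use eig in \<open>simp_all add: B'_def\<close>)
    then show ?thesis by simp
  qed
  have sq: "0 < (\<Sum>v\<in>?V. (x v)\<^sup>2)"
  proof -
    have "A' \<noteq> {}" using A'(2) by auto
    then obtain v where "v \<in> ?V" using A'(1) sub(1) by blast
    then show ?thesis using pos[of v] by (intro sum_squares_pos[of _ v]) auto
  qed
  have ge: "quad_form ?V (sep_dist A B) x \<le> quad_form ?V (distance_on G) x"
    by (rule quad_form_mono_positive(1)[OF finite_verts pos le])
  have lH: "?lH * (\<Sum>v\<in>?V. (x v)\<^sup>2) = quad_form ?V (sep_dist A' B') x"
    using quad_form_eigenpair_on[OF eig] by simp
  have "?lH * (\<Sum>v\<in>?V. (x v)\<^sup>2) \<le> ?lG * (\<Sum>v\<in>?V. (x v)\<^sup>2)"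
    using lH step ge bound by linarith
  then have main: "?lH \<le> ?lG" using sq by simp

  \<comment> \<open>The equality case\<close>
  have "digraph_iso G H" if eq: "?lG = ?lH"
  proof -
    \<comment> \<open>The chain of forms now has equal ends, so every inequality in it is an
      equality.\<close>
    have "quad_form ?V (sep_dist A' B') x = quad_form ?V (sep_dist A B) x"
      and eqG: "quad_form ?V (sep_dist A B) x = quad_form ?V (distance_on G) x"
      using lH step ge bound unfolding eq by linarith+
    with step have "A' = A" by auto
    then have "B' = B" by (simp add: B'_def)
    have distG: "distance_on G u v = distance_on H (\<phi> u) (\<phi> v)" if "u \<in> ?V" "v \<in> ?V" for u v
    proof -
      have "sep_dist A B u v = distance_on G u v"
        by (rule quad_form_mono_positive(2)[OF finite_verts pos le eqG]) (use that in auto)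
      then show ?thesis using dist\<phi>[OF that] \<open>A' = A\<close> \<open>B' = B\<close> by simp
    qed
    have adj: "u \<rightarrow>\<^bsub>G\<^esub> v \<longleftrightarrow> (\<phi> u, \<phi> v) \<in> parcs (extremal_graph \<kappa> ?m)" if "u \<in> ?V" "v \<in> ?V" for u v
    proof -
      have \<phi>uv: "\<phi> u \<in> verts H" "\<phi> v \<in> verts H" using bij that by (auto dest: bij_betwE)
      have "u \<rightarrow>\<^bsub>G\<^esub> v \<longleftrightarrow> graph_dist G u v = 1"
        using graph_dist_conv_adj[OF con that] .
      also have "\<dots> \<longleftrightarrow> graph_dist H (\<phi> u) (\<phi> v) = 1" using distG[OF that] by simp
      also have "\<dots> \<longleftrightarrow> \<phi> u \<rightarrow>\<^bsub>H\<^esub> \<phi> v" using H.graph_dist_conv_adj[OF conH \<phi>uv] by simp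
      finally show ?thesis unfolding H_def by simp
    qed
    show ?thesis unfolding H_def
      by (rule digraph_iso_with_projI[OF _ _ adj]) (use bij H.wf_digraph in \<open>auto simp: H_def\<close>)
  qed
  then show ?thesis using main largest_eigenvalue_distance_matrix_iso[OF con] by blast
qed

end
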